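(* Let $n \geq 2$ be an integer, and for all $i, j \in \{1, \ldots, n\}$ with $i \neq j$ let $p_{ij} \in (0,1)$ be real numbers satisfying $p_{ij} + p_{ji} = 1$ (no other assumption is made on the $p_{ij}$). Let $K$ be the $n! \times n!$ transition matrix, indexed by the permutations of $\{1, \ldots, n\}$, of the adjacent-transposition Markov chain with parameters $(p_{ij})$. Let $I$ be the $n! \times n!$ identity matrix. Then the matrices $K$ and $I - K$ are similar. Therefore, the eigenvalues of $K$ (listed with multiplicity) occur in pairs summing to $1$, and the spectrum of $K$ lies in $[0,1]$.
   Context: A permutation is written as a list $x = (x_1, \ldots, x_n)$ of the elements of $\{1, \ldots, n\}$, each appearing exactly once. The adjacent-transposition Markov chain with parameters $(p_{ij})$ moves as follows: from the current permutation $x = (x_1, \ldots, x_n)$, choose a position $r \in \{2, \ldots, n\}$ uniformly at random; with probability $p_{x_r, x_{r-1}}$ move to $(x_1, \ldots, x_{r-2}, x_r, x_{r-1}, x_{r+1}, \ldots, x_n)$, and with the remaining probability stay at $x$. Formally, its transition matrix $K = (K_{xy})$ is given by: - if $x$ and $y$ differ precisely by a transposition of adjacent items $i$ and $j$, with $i$ immediately to the left of $j$ in $x$ and $j$ immediately to the left of $i$ in $y$, then $K_{xy} = p_{ji}/(n-1)$; - if not, and if $x \neq y$, then $K_{xy} = 0$; - $K_{xx} = 1 - \sum_{y \neq x} K_{xy}$. *)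

theory Defs
  imports
    "HOL-Combinatorics.Multiset_Permutations"
    "Jordan_Normal_Form.Spectral_Radius"
begin

text \<open>A permutation of \<open>{1..n}\<close>, written as a word, is an element of
  \<^term>\<open>permutations_of_set {1..n}\<close>.\<close>

definition adj_swap :: "nat \<Rightarrow> nat \<Rightarrow> nat list \<Rightarrow> nat list \<Rightarrow> bool" where
  "adj_swap i j x y \<longleftrightarrow> (\<exists>us vs. x = us @ [i, j] @ vs \<and> y = us @ [j, i] @ vs)"

text \<open>If \<open>x\<close> has no repetitions, then \<open>x\<close> and \<open>y\<close> determine the pair \<open>(i, j)\<close>
  (lemma \<open>adj_swap_unique\<close>), so that the \<open>THE\<close> below denotes the intended value.\<close>

definition jump_prob :: "nat \<Rightarrow> (nat \<Rightarrow> nat \<Rightarrow> real) \<Rightarrow> nat list \<Rightarrow> nat list \<Rightarrow> real" where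
  "jump_prob n p x y =
     (if \<exists>i j. adj_swap i j x y
      then (THE q. \<exists>i j. adj_swap i j x y \<and> q = p j i / (real n - 1))
      else 0)"

definition trans_prob :: "nat \<Rightarrow> (nat \<Rightarrow> nat \<Rightarrow> real) \<Rightarrow> nat list \<Rightarrow> nat list \<Rightarrow> real" where
  "trans_prob n p x y =
     (if x = y then 1 - (\<Sum>z \<in> permutations_of_set {1..n} - {x}. jump_prob n p x z)
      else jump_prob n p x y)"

text \<open>Rows and columns are indexed by numbers below \<open>n!\<close> through an enumeration \<open>e\<close> of the
  permutations.\<close>

definition trans_mat :: "nat \<Rightarrow> (nat \<Rightarrow> nat \<Rightarrow> real) \<Rightarrow> (nat \<Rightarrow> nat list) \<Rightarrow> real mat" where
  "trans_mat n p e = mat (fact n) (fact n) (\<lambda>(r, c). trans_prob n p (e r) (e c))"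

lemma adj_swap_unique:
  assumes "distinct x" "adj_swap i j x y" "adj_swap i' j' x y"
  shows "i' = i \<and> j' = j"
proof -
  obtain us vs where 1: "x = us @ [i, j] @ vs" "y = us @ [j, i] @ vs"
    using assms(2) unfolding adj_swap_def by blast
  obtain us' vs' where 2: "x = us' @ [i', j'] @ vs'" "y = us' @ [j', i'] @ vs'"
    using assms(3) unfolding adj_swap_def by blast
  have "distinct (us @ [i, j] @ vs)" "distinct (us' @ [i', j'] @ vs')"
    using assms(1) 1(1) 2(1) by metis+
  then have ne: "i \<noteq> j" "i' \<noteq> j'" by simp_all
  have first: "length u \<le> length u'"
    if "u @ [a, b] @ v = u' @ [a', b'] @ v'" "u @ [b, a] @ v = u' @ [b', a'] @ v'" "a \<noteq> b"
    for u u' v v' :: "nat list" and a b a' b'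
  proof (rule ccontr)
    assume *: "\<not> length u \<le> length u'"
    then have "(u @ [a, b] @ v) ! length u' = (u @ [b, a] @ v) ! length u'"
      by (simp add: nth_append)
    then have "a' = b'" unfolding that(1,2) by simp
    then have "u @ [a, b] @ v = u @ [b, a] @ v" using that(1,2) by simp
    then show False using \<open>a \<noteq> b\<close> by simp
  qed
  have "length us = length us'"
    using first[of us i j vs us' i' j' vs'] first[of us' i' j' vs' us i j vs] 1 2 ne by simp
  then show ?thesis using 1(1) 2(1) by simp
qed

lemma adj_swap_neq: "distinct x \<Longrightarrow> adj_swap i j x y \<Longrightarrow> x \<noteq> y"
  by (auto simp: adj_swap_def)

lemma trans_prob_adj_swap:
  assumes "distinct x" "adj_swap i j x y"
  shows "trans_prob n p x y = p j i / (real n - 1)"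
proof -
  have "(THE q. \<exists>i j. adj_swap i j x y \<and> q = p j i / (real n - 1)) = p j i / (real n - 1)"
    using assms adj_swap_unique[OF assms(1)] by (intro the_equality) blast+
  moreover have "x \<noteq> y" using adj_swap_neq assms .
  ultimately show ?thesis using assms(2) unfolding trans_prob_def jump_prob_def by auto
qed

lemma trans_prob_not_adj_swap:
  "x \<noteq> y \<Longrightarrow> (\<And>i j. \<not> adj_swap i j x y) \<Longrightarrow> trans_prob n p x y = 0"
  by (simp add: trans_prob_def jump_prob_def)

lemma trans_prob_diag:
  "trans_prob n p x x = 1 - (\<Sum>y \<in> permutations_of_set {1..n} - {x}. trans_prob n p x y)"
proof -
  have "(\<Sum>y \<in> permutations_of_set {1..n} - {x}. trans_prob n p x y)
      = (\<Sum>y \<in> permutations_of_set {1..n} - {x}. jump_prob n p x y)"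
    by (rule sum.cong) (auto simp: trans_prob_def)
  then show ?thesis by (simp add: trans_prob_def)
qed

end

theory Submission
  imports Defs "Jordan_Normal_Form.Schur_Decomposition"
begin

text \<open>
  Let \<open>d x = sgn x / w x\<close>, where \<open>w x\<close> is the product of \<open>p a b\<close> over all pairs with \<open>a\<close> to the
  left of \<open>b\<close> in \<open>x\<close>. A swap of adjacent items \<open>i, j\<close> available at \<open>x\<close> becomes a swap of \<open>j, i\<close>
  at \<open>rev x\<close>, so its probability changes from \<open>p j i / (n - 1)\<close> to \<open>p i j / (n - 1)\<close>; the ratio
  \<open>p j i / p i j\<close> is compensated by \<open>w\<close> and the minus sign of \<open>I - K\<close> by \<open>sgn\<close>. On the diagonal,
  the probabilities of leaving \<open>x\<close> and \<open>rev x\<close> add up to \<open>1\<close>. Hence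
  \<open>(I - K) (x, y) * d y = d x * K (rev x, rev y)\<close>, that is, \<open>K\<close> and \<open>I - K\<close> are similar.

  The chain is always reversible with respect to \<open>w\<close>, so its eigenvalues are real; they are at most
  \<open>1\<close> because \<open>K\<close> is stochastic, and then at least \<open>0\<close> by the symmetry \<open>a \<mapsto> 1 - a\<close>. The only fixed
  point \<open>1/2\<close> of this symmetry has even multiplicity because \<open>n!\<close> is even, so all eigenvalues can be
  paired.
\<close>

section \<open>Linear algebra\<close>

text \<open>The conjugating matrix \<open>P\<close> is the permutation matrix of the involution
  \<open>\<sigma>\<close> with row \<open>i\<close> scaled by \<open>d i\<close>. Conjugation of
  \<open>B\<close> by it has the entries \<open>d i * B $$ (\<sigma> i, \<sigma> j) / d j\<close>,
  which \<open>AB\<close> states without division.\<close>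

lemma similar_mat_twisted_perm:
  fixes A B :: "'a :: field mat"
  assumes A: "A \<in> carrier_mat N N" and B: "B \<in> carrier_mat N N"
    and \<sigma>: "\<And>i. i < N \<Longrightarrow> \<sigma> i < N" "\<And>i. i < N \<Longrightarrow> \<sigma> (\<sigma> i) = i"
    and d: "\<And>i. i < N \<Longrightarrow> d i \<noteq> 0"
    and AB: "\<And>i j. i < N \<Longrightarrow> j < N \<Longrightarrow> A $$ (i, j) * d j = d i * B $$ (\<sigma> i, \<sigma> j)"
  shows "similar_mat A B"
proof -
  define P where "P = mat N N (\<lambda>(i, j). if j = \<sigma> i then d i else 0)"
  define Q where "Q = mat N N (\<lambda>(i, j). if i = \<sigma> j then 1 / d j else 0)"
  have P: "P \<in> carrier_mat N N" and Q: "Q \<in> carrier_mat N N"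
    by (simp_all add: P_def Q_def)
  have swap: "j = \<sigma> i \<longleftrightarrow> i = \<sigma> j" if "i < N" "j < N" for i j
    using that \<sigma>(2) by metis
  have left: "(P * M) $$ (i, j) = d i * M $$ (\<sigma> i, j)"
    if "M \<in> carrier_mat N N" "i < N" "j < N" for M i j
  proof -
    have "(P * M) $$ (i, j) = (\<Sum>k = 0..<N. (if k = \<sigma> i then d i else 0) * M $$ (k, j))"
      using that by (simp add: P_def scalar_prod_def)
    also have "\<dots> = (\<Sum>k = 0..<N. if k = \<sigma> i then d i * M $$ (k, j) else 0)"
      by (rule sum.cong) auto
    also have "\<dots> = d i * M $$ (\<sigma> i, j)"
      using \<sigma>(1)[OF \<open>i < N\<close>] by simp
    finally show ?thesis .
  qed
  have right: "(M * Q) $$ (i, j) = M $$ (i, \<sigma> j) / d j"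
    if "M \<in> carrier_mat N N" "i < N" "j < N" for M i j
  proof -
    have "(M * Q) $$ (i, j) = (\<Sum>k = 0..<N. M $$ (i, k) * (if k = \<sigma> j then 1 / d j else 0))"
      using that by (simp add: Q_def scalar_prod_def)
    also have "\<dots> = (\<Sum>k = 0..<N. if k = \<sigma> j then M $$ (i, k) / d j else 0)"
      by (rule sum.cong) auto
    also have "\<dots> = M $$ (i, \<sigma> j) / d j"
      using \<sigma>(1)[OF \<open>j < N\<close>] by simp
    finally show ?thesis .
  qed
  have PQ: "P * Q = 1\<^sub>m N"
  proof (rule eq_matI)
    fix i j assume "i < dim_row (1\<^sub>m N :: 'a mat)" "j < dim_col (1\<^sub>m N :: 'a mat)"
    then have ij: "i < N" "j < N" by simp_all
    have "(P * Q) $$ (i, j) = d i * (if \<sigma> i = \<sigma> j then 1 / d j else 0)"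
      using ij \<sigma>(1) by (subst left[OF Q ij]) (simp add: Q_def)
    moreover have "\<sigma> i = \<sigma> j \<longleftrightarrow> i = j" using ij \<sigma>(2) by metis
    ultimately show "(P * Q) $$ (i, j) = 1\<^sub>m N $$ (i, j)" using ij d by simp
  qed (use P Q in auto)
  have QP: "Q * P = 1\<^sub>m N"
    using mat_mult_left_right_inverse[OF P Q PQ] .
  have "A = P * B * Q"
  proof (rule eq_matI)
    fix i j assume "i < dim_row (P * B * Q)" "j < dim_col (P * B * Q)"
    then have ij: "i < N" "j < N" using P Q by simp_all
    have "(P * B * Q) $$ (i, j) = d i * B $$ (\<sigma> i, \<sigma> j) / d j"
      using P B ij \<sigma>(1) by (simp add: right left[OF B] del: index_mult_mat(1))
    also have "\<dots> = A $$ (i, j)"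
      unfolding AB[OF ij, symmetric] using d[OF ij(2)] by simp
    finally show "A $$ (i, j) = (P * B * Q) $$ (i, j)" by (rule sym)
  qed (use A P Q in auto)
  then show ?thesis
    by (intro similar_matI[of _ _ P Q N]) (use A B P Q PQ QP in auto)
qed

section \<open>Spectral constraints for reversible and for stochastic real matrices\<close>

lemma index_mult_mat_vec_sum:
  assumes "A \<in> carrier_mat N N" "v \<in> carrier_vec N" "i < N"
  shows "(A *\<^sub>v v) $ i = (\<Sum>j<N. A $$ (i, j) * v $ j)"
  using assms by (simp add: scalar_prod_def lessThan_atLeast0)

text \<open>Detailed balance makes \<open>A\<close> self-adjoint for the inner product weighted by
  \<open>w\<close>, and self-adjoint operators have real eigenvalues.\<close>

lemma eigenvalue_real_if_reversible:
  fixes A :: "real mat"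
  assumes A: "A \<in> carrier_mat N N"
    and w: "\<And>i. i < N \<Longrightarrow> 0 < w i"
    and bal: "\<And>i j. i < N \<Longrightarrow> j < N \<Longrightarrow> w i * A $$ (i, j) = w j * A $$ (j, i)"
    and k: "eigenvalue (map_mat complex_of_real A) k"
  shows "k \<in> \<real>"
proof -
  let ?A = "map_mat complex_of_real A"
  have cA: "?A \<in> carrier_mat N N" using A by simp
  obtain v where v: "v \<in> carrier_vec N" "v \<noteq> 0\<^sub>v N" "?A *\<^sub>v v = k \<cdot>\<^sub>v v"
    using k A unfolding eigenvalue_def eigenvector_def by auto
  have Av: "(\<Sum>j<N. of_real (A $$ (i, j)) * v $ j) = k * v $ i" if "i < N" for i
  proof -
    have "(\<Sum>j<N. of_real (A $$ (i, j)) * v $ j) = (?A *\<^sub>v v) $ i"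
      using A that by (subst index_mult_mat_vec_sum[OF cA v(1) that]) (auto intro!: sum.cong)
    then show ?thesis using v(1,3) that by simp
  qed
  \<comment> \<open>For the weighted inner product, \<open>s\<close> is the squared norm of
    \<open>v\<close> and \<open>t\<close> is the product of \<open>v\<close> with its image under
    \<open>A\<close>. The eigenvector equation gives \<open>t = k * s\<close>, and symmetry makes
    \<open>t\<close> real.\<close>
  define s where "s = (\<Sum>i<N. w i * (cmod (v $ i))\<^sup>2)"
  define t where "t = (\<Sum>i<N. \<Sum>j<N. of_real (w i * A $$ (i, j)) * (cnj (v $ i) * v $ j))"
  have "t = (\<Sum>i<N. of_real (w i) * cnj (v $ i) * (k * v $ i))"
    unfolding t_def
    by (rule sum.cong) (auto simp: Av[symmetric] sum_distrib_left algebra_simps)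
  also have "\<dots> = k * of_real s"
    unfolding s_def of_real_sum sum_distrib_left
    by (rule sum.cong) (auto simp: complex_norm_square algebra_simps simp del: of_real_power)
  finally have t: "t = k * of_real s" .
  have "cnj t = (\<Sum>i<N. \<Sum>j<N. of_real (w i * A $$ (i, j)) * (v $ i * cnj (v $ j)))"
    by (simp add: t_def)
  \<comment> \<open>After the exchange of the two sums, \<open>bal\<close> turns each summand into
    the one of \<open>t\<close> with the indices interchanged.\<close>
  also have "\<dots> = (\<Sum>j<N. \<Sum>i<N. of_real (w i * A $$ (i, j)) * (v $ i * cnj (v $ j)))"
    by (rule sum.swap)
  also have "\<dots> = t"
    unfolding t_def by (intro sum.cong refl) (simp add: bal mult.commute)
  finally have "cnj k * of_real s = k * of_real s" by (simp add: t)
  moreover have "s \<noteq> 0"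
  proof -
    have nonneg: "0 \<le> w i * (cmod (v $ i))\<^sup>2" if "i < N" for i
      using w[OF that] by simp
    obtain i where i: "i < N" "v $ i \<noteq> 0"
      using v(1,2) by (metis carrier_vecD eq_vecI index_zero_vec)
    have "0 < w i * (cmod (v $ i))\<^sup>2" using w i by simp
    also have "\<dots> \<le> s"
      unfolding s_def using i nonneg by (intro member_le_sum) auto
    finally show ?thesis by simp
  qed
  ultimately have "cnj k = k" by simp
  then show ?thesis by (simp add: Reals_cnj_iff)
qed

text \<open>At a coordinate \<open>m\<close> where an eigenvector has maximal modulus,
  \<open>k * v $ m\<close> is a convex combination of entries of modulus at most
  \<open>cmod (v $ m)\<close>.\<close>

lemma norm_eigenvalue_le_1_if_stochastic:
  fixes A :: "real mat"
  assumes A: "A \<in> carrier_mat N N"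
    and nonneg: "\<And>i j. i < N \<Longrightarrow> j < N \<Longrightarrow> 0 \<le> A $$ (i, j)"
    and row: "\<And>i. i < N \<Longrightarrow> (\<Sum>j<N. A $$ (i, j)) = 1"
    and k: "eigenvalue (map_mat complex_of_real A) k"
  shows "cmod k \<le> 1"
proof -
  let ?A = "map_mat complex_of_real A"
  have cA: "?A \<in> carrier_mat N N" using A by simp
  obtain v where v: "v \<in> carrier_vec N" "v \<noteq> 0\<^sub>v N" "?A *\<^sub>v v = k \<cdot>\<^sub>v v"
    using k A unfolding eigenvalue_def eigenvector_def by auto
  obtain l where l: "l < N" "v $ l \<noteq> 0"
    using v(1,2) by (metis carrier_vecD eq_vecI index_zero_vec)
  have "Max ((\<lambda>i. cmod (v $ i)) ` {..<N}) \<in> (\<lambda>i. cmod (v $ i)) ` {..<N}"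
    using l by (intro Max_in) auto
  then obtain m where m: "m < N" "cmod (v $ m) = Max ((\<lambda>i. cmod (v $ i)) ` {..<N})"
    by auto
  have max: "cmod (v $ j) \<le> cmod (v $ m)" if "j < N" for j
    unfolding m(2) using that by (intro Max_ge) auto
  have "cmod k * cmod (v $ m) = cmod ((?A *\<^sub>v v) $ m)"
    using v(1,3) m(1) by (simp add: norm_mult)
  also have "\<dots> = cmod (\<Sum>j<N. of_real (A $$ (m, j)) * v $ j)"
    using A m(1)
    by (subst index_mult_mat_vec_sum[OF cA v(1) m(1)])
      (auto intro!: sum.cong arg_cong[of _ _ cmod])
  also have "\<dots> \<le> (\<Sum>j<N. A $$ (m, j) * cmod (v $ m))"
    by (rule sum_norm_le) (use nonneg m(1) max in \<open>auto simp: norm_mult intro!: mult_left_mono\<close>)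
  also have "\<dots> = cmod (v $ m)"
    by (simp add: row[OF m(1)] flip: sum_distrib_right)
  finally have "cmod k * cmod (v $ m) \<le> 1 * cmod (v $ m)" by simp
  moreover have "0 < cmod (v $ m)" using max[OF l(1)] l(2) by (meson less_le_trans zero_less_norm_iff)
  ultimately show ?thesis by simp
qed

section \<open>Multisets of roots under the reflection \<open>a \<mapsto> 1 - a\<close>\<close>

lemma proots_prod_list_linear:
  "proots (\<Prod>a\<leftarrow>as. [:- a, 1:]) = mset (as :: 'a :: idom list)"
proof (induction as)
  case (Cons a as)
  have "(\<Prod>a\<leftarrow>as. [:- a, 1:]) \<noteq> 0" by (auto simp: prod_list_zero_iff)
  then show ?case using Cons by (simp add: proots_mult del: mult_pCons_left)
qed simp

text \<open>Over the complex numbers \<open>A\<close> is similar to an upper triangular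
  \<open>B\<close>. The same \<open>P\<close> and \<open>Q\<close> conjugate \<open>1 - A\<close> to
  \<open>1 - B\<close>, so both root multisets can be read off the diagonals.\<close>

lemma proots_char_poly_one_minus:
  fixes A :: "complex mat"
  assumes A: "A \<in> carrier_mat N N"
  shows "proots (char_poly (1\<^sub>m N - A)) = image_mset (\<lambda>a. 1 - a) (proots (char_poly A))"
proof -
  obtain B where B: "B \<in> carrier_mat N N" "upper_triangular B" "similar_mat A B"
    using schur_decomposition_exists[OF A] char_poly_factorized[OF A] by blast
  obtain P Q where PQ: "similar_mat_wit A B P Q"
    using B(3) unfolding similar_mat_def by blast
  note wit = similar_mat_witD2[OF A PQ]
  have P: "P \<in> carrier_mat N N" and Q: "Q \<in> carrier_mat N N" using wit by auto
  have "1\<^sub>m N - A = P * (1\<^sub>m N - B) * Q"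
  proof -
    have "P * (1\<^sub>m N - B) * Q = (P - P * B) * Q"
      using P B(1) by (simp add: mult_minus_distrib_mat[OF P one_carrier_mat B(1)])
    also have "\<dots> = P * Q - P * B * Q"
      using P Q B(1) by (intro minus_mult_distrib_mat[of _ N N]) auto
    finally show ?thesis using wit(1,3) by (simp only:)
  qed
  then have "similar_mat (1\<^sub>m N - A) (1\<^sub>m N - B)"
    by (intro similar_matI[of _ _ P Q N]) (use wit A B(1) in auto)
  then have "char_poly (1\<^sub>m N - A) = char_poly (1\<^sub>m N - B)" by (rule char_poly_similar)
  also have "\<dots> = (\<Prod>a\<leftarrow>diag_mat (1\<^sub>m N - B). [:- a, 1:])"
    using B(1) upper_triangularD[OF B(2)]
    by (intro char_poly_upper_triangular[of _ N]) (auto intro!: upper_triangularI)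
  also have "diag_mat (1\<^sub>m N - B) = map (\<lambda>a. 1 - a) (diag_mat B)"
    using B(1) by (auto simp: diag_mat_def)
  finally have "proots (char_poly (1\<^sub>m N - A)) = image_mset (\<lambda>a. 1 - a) (mset (diag_mat B))"
    by (simp only: proots_prod_list_linear mset_map)
  moreover have "proots (char_poly A) = mset (diag_mat B)"
    using char_poly_similar[OF B(3)] char_poly_upper_triangular[OF B(1,2)]
    by (simp only: proots_prod_list_linear)
  ultimately show ?thesis by simp
qed

text \<open>The reflection matches the elements below \<open>1/2\<close> with those above. What
  remains are copies of \<open>1/2\<close>, evenly many by parity, which are paired among
  themselves.\<close>

lemma pair_up_reflected_multiset:
  fixes M :: "complex multiset"
  assumes refl: "image_mset (\<lambda>a. 1 - a) M = M" and re: "set_mset M \<subseteq> \<real>" and ev: "even (size M)"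
  shows "\<exists>P. M = image_mset fst P + image_mset snd P \<and> (\<forall>(a, b) \<in># P. a + b = 1)"
proof -
  define L where "L = filter_mset (\<lambda>a. Re a < 1/2) M"
  define R where "R = filter_mset (\<lambda>a. 1/2 < Re a) M"
  define C where "C = filter_mset (\<lambda>a. a = 1/2) M"
  have M: "M = L + R + C"
  proof (rule multiset_eqI)
    fix a
    \<comment> \<open>Reality enters here: a non-real element with real part \<open>1/2\<close>
      would belong to none of \<open>L\<close>, \<open>R\<close> and \<open>C\<close>.\<close>
    have "Re a = 1/2 \<longleftrightarrow> a = 1/2" if "a \<in># M"
      using that re by (auto simp: complex_eq_iff complex_is_Real_iff)
    then show "count M a = count (L + R + C) a"
      by (cases "a \<in># M") (auto simp: L_def R_def C_def not_in_iff)
  qed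
  have "R = filter_mset (\<lambda>a. 1/2 < Re a) (image_mset (\<lambda>a. 1 - a) M)"
    by (simp add: R_def refl)
  also have "\<dots> = image_mset (\<lambda>a. 1 - a) (filter_mset (\<lambda>a. 1/2 < Re (1 - a)) M)"
    by (simp add: filter_mset_image_mset)
  also have "filter_mset (\<lambda>a. 1/2 < Re (1 - a)) M = L"
    unfolding L_def by (rule filter_mset_cong) auto
  finally have R: "R = image_mset (\<lambda>a. 1 - a) L" .
  have "size M = 2 * size L + size C" by (simp add: M R)
  then have "even (size C)" using ev by simp
  then obtain k where k: "size C = k + k" by (metis evenE mult_2)
  have "C = replicate_mset (size C) (1/2)"
    unfolding C_def by (metis (mono_tags) filter_eq_replicate_mset size_replicate_mset)
  then have C: "C = replicate_mset k (1/2) + replicate_mset k (1/2)"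
    unfolding k by (auto simp: multiset_eq_iff)
  define P where "P = image_mset (\<lambda>a. (a, 1 - a)) L + replicate_mset k (1/2, 1/2)"
  have "M = image_mset fst P + image_mset snd P"
    by (simp add: M R C P_def image_mset.compositionality comp_def)
  moreover have "\<forall>(a, b) \<in># P. a + b = 1"
    by (auto simp: P_def split: if_splits)
  ultimately show ?thesis by blast
qed

section \<open>Words and adjacent swaps\<close>

text \<open>For \<open>q = p\<close> this is the weight \<open>w\<close>, an unnormalised stationary
  distribution of the chain. Keeping \<open>q\<close> general allows the same product to define
  \<open>twist\<close>.\<close>

fun pair_prod :: "('a \<Rightarrow> 'a \<Rightarrow> 'b :: comm_monoid_mult) \<Rightarrow> 'a list \<Rightarrow> 'b" where
  "pair_prod q [] = 1"
| "pair_prod q (a # xs) = (\<Prod>b\<leftarrow>xs. q a b) * pair_prod q xs"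

text \<open>An adjacent swap changes the relative order of the pair \<open>i\<close>,
  \<open>j\<close> only, so all other factors agree. The crosswise form avoids division and holds in
  every commutative monoid.\<close>

lemma pair_prod_adj_swap:
  assumes "adj_swap i j x y"
  shows "pair_prod q x * q j i = pair_prod q y * q i j"
proof -
  have "pair_prod q (us @ [i, j] @ vs) * q j i = pair_prod q (us @ [j, i] @ vs) * q i j" for us vs
  proof (induction us)
    case (Cons a us)
    have "(\<Prod>b\<leftarrow>us @ [i, j] @ vs. q a b) = (\<Prod>b\<leftarrow>us @ [j, i] @ vs. q a b)"
      by (simp add: ac_simps)
    with Cons show ?case by (simp only: append_Cons pair_prod.simps mult.assoc)
  qed (simp add: ac_simps)
  then show ?thesis using assms unfolding adj_swap_def by blast
qed

lemma pair_prod_pos: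
  fixes q :: "'a \<Rightarrow> 'a \<Rightarrow> real"
  assumes "distinct x" "\<And>a b. a \<in> set x \<Longrightarrow> b \<in> set x \<Longrightarrow> a \<noteq> b \<Longrightarrow> 0 < q a b"
  shows "0 < pair_prod q x"
  using assms
proof (induction x)
  case (Cons a x)
  have "0 < prod_list (map f xs)" if "\<And>b. b \<in> set xs \<Longrightarrow> 0 < f b" for f :: "'a \<Rightarrow> real" and xs
    using that by (induction xs) auto
  moreover have "0 < q a b" if "b \<in> set x" for b
    using Cons.prems that by (metis distinct.simps(2) list.set_intros)
  ultimately have "0 < (\<Prod>b\<leftarrow>x. q a b)" by blast
  then show ?case using Cons by simp
qed simp

lemma pair_prod_nonzero:
  fixes q :: "'a \<Rightarrow> 'a \<Rightarrow> real"
  assumes "distinct x" "\<And>a b. a \<in> set x \<Longrightarrow> b \<in> set x \<Longrightarrow> a \<noteq> b \<Longrightarrow> q a b \<noteq> 0"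
  shows "pair_prod q x \<noteq> 0"
  using assms
proof (induction x)
  case (Cons a x)
  have "q a b \<noteq> 0" if "b \<in> set x" for b
    using Cons.prems that by (metis distinct.simps(2) list.set_intros)
  then have "(\<Prod>b\<leftarrow>x. q a b) \<noteq> 0" by (auto simp: prod_list_zero_iff)
  then show ?case using Cons by simp
qed simp

section \<open>Adjacent swaps: symmetry, reversal and the number of neighbours\<close>

lemma adj_swap_sym: "adj_swap i j x y \<Longrightarrow> adj_swap j i y x"
  unfolding adj_swap_def by blast

lemma adj_swap_rev:
  assumes "adj_swap i j x y"
  shows "adj_swap j i (rev x) (rev y)"
proof -
  obtain us vs where "x = us @ [i, j] @ vs" "y = us @ [j, i] @ vs"
    using assms unfolding adj_swap_def by blast
  then have "rev x = rev vs @ [j, i] @ rev us" "rev y = rev vs @ [i, j] @ rev us" by simp_all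
  then show ?thesis unfolding adj_swap_def by blast
qed

lemma adj_swap_rev_iff: "adj_swap i j (rev x) (rev y) \<longleftrightarrow> adj_swap j i x y"
  using adj_swap_rev[of i j "rev x" "rev y"] adj_swap_rev[of j i x y] by auto

lemma adj_swap_permutations:
  "adj_swap i j x y \<Longrightarrow> x \<in> permutations_of_set A \<Longrightarrow> y \<in> permutations_of_set A"
  by (auto simp: adj_swap_def permutations_of_set_def)

lemma adj_swap_items:
  assumes "adj_swap i j x y" "distinct x"
  shows "i \<in> set x" "j \<in> set x" "i \<noteq> j"
  using assms by (auto simp: adj_swap_def)

text \<open>The recursion behind the count of neighbours: a swap either involves the first two items
  or takes place in the tail.\<close>

lemma neighbours_Cons_Cons:
  "{y. \<exists>i j. adj_swap i j (a # b # x) y}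
    = insert (b # a # x) ((#) a ` {y. \<exists>i j. adj_swap i j (b # x) y})"
proof (intro Set.set_eqI iffI)
  fix y assume "y \<in> {y. \<exists>i j. adj_swap i j (a # b # x) y}"
  then obtain i j us vs where *: "a # b # x = us @ [i, j] @ vs" "y = us @ [j, i] @ vs"
    unfolding adj_swap_def by blast
  show "y \<in> insert (b # a # x) ((#) a ` {y. \<exists>i j. adj_swap i j (b # x) y})"
  proof (cases us)
    case Nil
    then show ?thesis using * by simp
  next
    case (Cons u us')
    then have "adj_swap i j (b # x) (us' @ [j, i] @ vs)" "y = a # us' @ [j, i] @ vs"
      using * unfolding adj_swap_def by auto
    then show ?thesis by blast
  qed
next
  fix y assume "y \<in> insert (b # a # x) ((#) a ` {y. \<exists>i j. adj_swap i j (b # x) y})"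
  then consider "y = b # a # x" | i j z where "y = a # z" "adj_swap i j (b # x) z" by blast
  then show "y \<in> {y. \<exists>i j. adj_swap i j (a # b # x) y}"
  proof cases
    case 1
    then have "adj_swap a b (a # b # x) y" unfolding adj_swap_def by (intro exI[of _ "[]"] exI[of _ x]) simp
    then show ?thesis by blast
  next
    case 2
    then obtain us vs where "b # x = us @ [i, j] @ vs" "z = us @ [j, i] @ vs"
      unfolding adj_swap_def by blast
    then have "adj_swap i j (a # b # x) y"
      unfolding adj_swap_def 2 by (intro exI[of _ "a # us"] exI[of _ vs]) simp
    then show ?thesis by blast
  qed
qed

text \<open>Since \<open>a\<close> and \<open>b\<close> differ, the swap at the front is not among
  those in the tail, so each further letter adds one neighbour. Finiteness is carried along because
  the cardinality of an insertion requires it.\<close>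

lemma card_neighbours:
  assumes "distinct x"
  shows "card {y. \<exists>i j. adj_swap i j x y} = length x - 1 \<and> finite {y. \<exists>i j. adj_swap i j x y}"
  using assms
proof (induction x rule: induct_list012)
  case (3 a b x)
  then have "b # a # x \<notin> (#) a ` {y. \<exists>i j. adj_swap i j (b # x) y}" by auto
  then show ?case using 3 unfolding neighbours_Cons_Cons by (simp add: card_image)
qed (auto simp: adj_swap_def Cons_eq_append_conv)

section \<open>The transition probabilities\<close>

text \<open>The numerators multiply to the sign of the permutation.\<close>

definition twist :: "(nat \<Rightarrow> nat \<Rightarrow> real) \<Rightarrow> nat list \<Rightarrow> real" where
  "twist p = pair_prod (\<lambda>a b. (if a < b then 1 else -1) / p a b)"

context
  fixes n :: nat and p :: "nat \<Rightarrow> nat \<Rightarrow> real"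
  assumes n: "n \<ge> 2"
    and pos: "\<And>i j. i \<in> {1..n} \<Longrightarrow> j \<in> {1..n} \<Longrightarrow> i \<noteq> j \<Longrightarrow> 0 < p i j"
    and compl: "\<And>i j. i \<in> {1..n} \<Longrightarrow> j \<in> {1..n} \<Longrightarrow> i \<noteq> j \<Longrightarrow> p i j + p j i = 1"
begin

lemma trans_prob_neq_nonneg:
  assumes "x \<in> permutations_of_set {1..n}" "x \<noteq> y"
  shows "0 \<le> trans_prob n p x y"
proof (cases "\<exists>i j. adj_swap i j x y")
  case True
  then obtain i j where ij: "adj_swap i j x y" by blast
  have "distinct x" "set x = {1..n}" using assms(1) by (auto dest: permutations_of_setD)
  then show ?thesis
    using trans_prob_adj_swap[OF _ ij] adj_swap_items[OF ij] pos[of j i] n by auto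
next
  case False
  then show ?thesis using trans_prob_not_adj_swap[OF assms(2), of n p] by auto
qed

text \<open>Each neighbour \<open>y\<close> of \<open>x\<close> adds
  \<open>(p j i + p i j) / (n - 1) = 1 / (n - 1)\<close> to the combined probability of leaving
  \<open>x\<close> and \<open>rev x\<close>. There are \<open>n - 1\<close> neighbours, so this
  total is \<open>1\<close>.\<close>

lemma trans_prob_diag_rev:
  assumes x: "x \<in> permutations_of_set {1..n}"
  shows "trans_prob n p x x + trans_prob n p (rev x) (rev x) = 1"
proof -
  let ?S = "permutations_of_set {1..n}"
  let ?K = "trans_prob n p"
  let ?N = "{y. \<exists>i j. adj_swap i j x y}"
  have dx: "distinct x" "set x = {1..n}" using x by (auto dest: permutations_of_setD)
  have "length x = n" using x by (simp add: length_finite_permutations_of_set)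
  have sub: "?N \<subseteq> ?S - {x}"
    using adj_swap_permutations[OF _ x] adj_swap_neq[OF dx(1)] by blast
  \<comment> \<open>Reindexing by reversal brings both sums over the same set, where they can be
    added term by term.\<close>
  have "bij_betw rev (?S - {x}) (?S - {rev x})"
    by (rule bij_betwI[of _ _ _ rev]) (auto simp: permutations_of_set_def)
  then have "(\<Sum>y\<in>?S - {rev x}. ?K (rev x) y) = (\<Sum>y\<in>?S - {x}. ?K (rev x) (rev y))"
    by (rule sum.reindex_bij_betw[symmetric])
  then have "(\<Sum>y\<in>?S - {x}. ?K x y) + (\<Sum>y\<in>?S - {rev x}. ?K (rev x) y)
      = (\<Sum>y\<in>?S - {x}. ?K x y + ?K (rev x) (rev y))"
    by (simp add: sum.distrib)
  also have "\<dots> = (\<Sum>y\<in>?S - {x}. if y \<in> ?N then 1 / (real n - 1) else 0)"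
  proof (rule sum.cong)
    fix y assume y: "y \<in> ?S - {x}"
    show "?K x y + ?K (rev x) (rev y) = (if y \<in> ?N then 1 / (real n - 1) else 0)"
    proof (cases "y \<in> ?N")
      case True
      then obtain i j where ij: "adj_swap i j x y" by blast
      have "?K x y + ?K (rev x) (rev y) = (p j i + p i j) / (real n - 1)"
        using trans_prob_adj_swap[OF dx(1) ij] trans_prob_adj_swap[OF _ adj_swap_rev[OF ij]] dx(1)
        by (simp add: add_divide_distrib)
      also have "p j i + p i j = 1"
        using adj_swap_items[OF ij dx(1)] dx(2) compl by simp
      finally show ?thesis using True by simp
    next
      case False
      then have "\<not> adj_swap i j x y" "\<not> adj_swap i j (rev x) (rev y)" for i j
        by (auto simp: adj_swap_rev_iff)
      then show ?thesis using y False by (auto simp: trans_prob_not_adj_swap)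
    qed
  qed simp
  also have "\<dots> = (\<Sum>y\<in>?N. 1 / (real n - 1))"
    using sub by (subst sum.inter_restrict[symmetric]) (auto simp: Int_absorb1)
  also have "\<dots> = 1"
    using card_neighbours[OF dx(1)] n \<open>length x = n\<close> by (simp add: of_nat_diff)
  finally show ?thesis by (simp add: trans_prob_diag[of n p x] trans_prob_diag[of n p "rev x"])
qed

text \<open>The probability of staying at \<open>x\<close> equals that of leaving
  \<open>rev x\<close>, which is a sum of nonnegative off-diagonal entries.\<close>

lemma trans_prob_nonneg:
  assumes x: "x \<in> permutations_of_set {1..n}"
  shows "0 \<le> trans_prob n p x y"
proof (cases "x = y")
  case True
  have "rev x \<in> permutations_of_set {1..n}"
    using x by (auto simp: permutations_of_set_def)
  then have "0 \<le> (\<Sum>y\<in>permutations_of_set {1..n} - {rev x}. trans_prob n p (rev x) y)"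
    by (intro sum_nonneg trans_prob_neq_nonneg) auto
  then show ?thesis
    using trans_prob_diag_rev[OF x] trans_prob_diag[of n p "rev x"] True by simp
qed (use trans_prob_neq_nonneg[OF x] in simp)

text \<open>Detailed balance: for a swap it is \<open>pair_prod_adj_swap\<close> with
  \<open>q = p\<close>, divided by \<open>n - 1\<close>. In the remaining cases \<open>x = y\<close>
  or both sides vanish.\<close>

lemma trans_prob_reversible:
  assumes "x \<in> permutations_of_set {1..n}" "y \<in> permutations_of_set {1..n}"
  shows "pair_prod p x * trans_prob n p x y = pair_prod p y * trans_prob n p y x"
proof (cases "\<exists>i j. adj_swap i j x y")
  case True
  then obtain i j where ij: "adj_swap i j x y" by blast
  then show ?thesis
    using trans_prob_adj_swap[OF _ ij] trans_prob_adj_swap[OF _ adj_swap_sym[OF ij]]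
      pair_prod_adj_swap[OF ij, of p] assms
    by (simp add: permutations_of_setD)
next
  case False
  then have "\<And>i j. \<not> adj_swap i j x y" "\<And>i j. \<not> adj_swap i j y x"
    using adj_swap_sym by blast+
  then show ?thesis by (cases "x = y") (simp_all add: trans_prob_not_adj_swap)
qed

lemma twist_nonzero:
  assumes x: "x \<in> permutations_of_set {1..n}"
  shows "twist p x \<noteq> 0"
  unfolding twist_def
proof (rule pair_prod_nonzero)
  show "distinct x" using x by (rule permutations_of_setD)
  fix a b assume "a \<in> set x" "b \<in> set x" "a \<noteq> b"
  moreover have "set x = {1..n}" using x by (rule permutations_of_setD)
  ultimately have "0 < p a b" using pos[of a b] by simp
  then show "(if a < b then 1 else - 1) / p a b \<noteq> 0" by simp
qed

text \<open>This is the entrywise hypothesis of \<open>similar_mat_twisted_perm\<close>, with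
  reversal as the involution and \<open>twist p\<close> as the scaling.\<close>

lemma trans_prob_twist:
  assumes x: "x \<in> permutations_of_set {1..n}" and y: "y \<in> permutations_of_set {1..n}"
  shows "((if x = y then 1 else 0) - trans_prob n p x y) * twist p y
    = twist p x * trans_prob n p (rev x) (rev y)"
proof (cases "x = y")
  case True
  have "1 - trans_prob n p x x = trans_prob n p (rev x) (rev x)"
    using trans_prob_diag_rev[OF x] by linarith
  then show ?thesis using True by simp
next
  case False
  have dx: "distinct x" "set x = {1..n}" using x by (auto dest: permutations_of_setD)
  show ?thesis
  proof (cases "\<exists>i j. adj_swap i j x y")
    case True
    then obtain i j where ij: "adj_swap i j x y" by blast
    have items: "i \<in> {1..n}" "j \<in> {1..n}" "i \<noteq> j" using adj_swap_items[OF ij dx(1)] dx(2) by auto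
    then have "0 < p i j" "0 < p j i" using pos by auto
    moreover have "twist p x * ((if j < i then 1 else -1) / p j i)
        = twist p y * ((if i < j then 1 else -1) / p i j)"
      unfolding twist_def by (rule pair_prod_adj_swap[OF ij])
    \<comment> \<open>As \<open>i \<noteq> j\<close>, exactly one of the two numerators is
      \<open>-1\<close>; this yields the minus sign.\<close>
    ultimately have "twist p x * p i j = - (twist p y * p j i)"
      using items(3) by (auto simp: field_simps split: if_splits)
    moreover have "trans_prob n p x y = p j i / (real n - 1)"
      "trans_prob n p (rev x) (rev y) = p i j / (real n - 1)"
      using trans_prob_adj_swap[OF dx(1) ij] trans_prob_adj_swap[OF _ adj_swap_rev[OF ij]] dx(1)
      by auto
    ultimately show ?thesis using False by (simp add: mult.commute)
  next
    case no: False
    then have "\<not> adj_swap i j x y" "\<not> adj_swap i j (rev x) (rev y)" for i j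
      by (auto simp: adj_swap_rev_iff)
    then show ?thesis using False by (simp add: trans_prob_not_adj_swap)
  qed
qed

end

text \<open>Roots of the complex characteristic polynomial count eigenvalues with algebraic
  multiplicity, and the multiset \<open>P\<close> lists the pairs. Reality of the eigenvalues is
  part of the last claim, as the spectrum is taken over the complex numbers.\<close>

theorem theorem2:
  fixes n :: nat and p :: "nat \<Rightarrow> nat \<Rightarrow> real" and e :: "nat \<Rightarrow> nat list"
  assumes "n \<ge> 2"
    and "\<And>i j. i \<in> {1..n} \<Longrightarrow> j \<in> {1..n} \<Longrightarrow> i \<noteq> j \<Longrightarrow> 0 < p i j \<and> p i j < 1"
    and "\<And>i j. i \<in> {1..n} \<Longrightarrow> j \<in> {1..n} \<Longrightarrow> i \<noteq> j \<Longrightarrow> p i j + p j i = 1"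
    and "bij_betw e {..<fact n} (permutations_of_set {1..n})"
  shows "similar_mat (trans_mat n p e) (1\<^sub>m (fact n) - trans_mat n p e)
    \<and> (\<exists>P :: (complex \<times> complex) multiset.
          proots (char_poly (map_mat complex_of_real (trans_mat n p e)))
            = image_mset fst P + image_mset snd P
        \<and> (\<forall>(a, b) \<in># P. a + b = 1))
    \<and> spectrum (map_mat complex_of_real (trans_mat n p e)) \<subseteq> complex_of_real ` {0..1}"
proof -
  define N :: nat where "N = fact n"
  let ?S = "permutations_of_set {1..n}"
  let ?K = "trans_mat n p e"
  let ?C = "map_mat complex_of_real ?K"
  have pos: "\<And>i j. i \<in> {1..n} \<Longrightarrow> j \<in> {1..n} \<Longrightarrow> i \<noteq> j \<Longrightarrow> 0 < p i j"
    using assms(2) by blast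
  note facts = assms(1) pos assms(3)
  have e: "bij_betw e {..<N} ?S" using assms(4) by (simp add: N_def)
  then have eS: "e i \<in> ?S" if "i < N" for i using that by (auto simp: bij_betw_def)
  have K: "?K \<in> carrier_mat N N" by (simp add: trans_mat_def N_def)
  then have C: "?C \<in> carrier_mat N N" by simp
  have Kij: "?K $$ (i, j) = trans_prob n p (e i) (e j)" if "i < N" "j < N" for i j
    using that by (simp add: trans_mat_def N_def)
  \<comment> \<open>Word reversal, transported to indices through the enumeration
    \<open>e\<close>.\<close>
  define \<sigma> where "\<sigma> i = the_inv_into {..<N} e (rev (e i))" for i
  have rS: "rev (e i) \<in> ?S" if "i < N" for i
    using eS[OF that] by (auto simp: permutations_of_set_def)
  have \<sigma>: "\<sigma> i < N" "e (\<sigma> i) = rev (e i)" if "i < N" for i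
    using rS[OF that] e the_inv_into_into[of e "{..<N}" "rev (e i)" "{..<N}"]
      f_the_inv_into_f[of e "{..<N}" "rev (e i)"]
    by (auto simp: bij_betw_def \<sigma>_def)
  have inj: "i = j" if "i < N" "j < N" "e i = e j" for i j
    using e that by (auto simp: bij_betw_def inj_on_def)
  have sim: "similar_mat (1\<^sub>m N - ?K) ?K"
  proof (rule similar_mat_twisted_perm[of _ N _ \<sigma> "\<lambda>i. twist p (e i)"])
    show "\<sigma> (\<sigma> i) = i" if "i < N" for i
      using that by (intro inj) (simp_all add: \<sigma>)
    show "twist p (e i) \<noteq> 0" if "i < N" for i
      using twist_nonzero[OF facts eS[OF that]] .
    show "(1\<^sub>m N - ?K) $$ (i, j) * twist p (e j) = twist p (e i) * ?K $$ (\<sigma> i, \<sigma> j)"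
      if ij: "i < N" "j < N" for i j
    proof -
      have "(1\<^sub>m N - ?K) $$ (i, j) = (if e i = e j then 1 else 0) - trans_prob n p (e i) (e j)"
        using ij K inj[OF ij] by (auto simp: Kij)
      then show ?thesis
        using trans_prob_twist[OF facts eS[OF ij(1)] eS[OF ij(2)]] ij by (simp add: Kij \<sigma>)
    qed
  qed (use K \<sigma> in auto)
  have refl: "image_mset (\<lambda>a. 1 - a) (proots (char_poly ?C)) = proots (char_poly ?C)"
  proof -
    \<comment> \<open>Similarity is known over the reals; the characteristic polynomials carry it
      over to the complex numbers, where the reflection of roots applies.\<close>
    have "1\<^sub>m N - ?C = map_mat complex_of_real (1\<^sub>m N - ?K)"
      using K by (intro eq_matI) auto
    then have "char_poly (1\<^sub>m N - ?C) = map_poly complex_of_real (char_poly (1\<^sub>m N - ?K))"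
      by (simp only:) (rule of_real_hom.char_poly_hom[of _ N], use K in auto)
    also have "\<dots> = char_poly ?C"
      unfolding char_poly_similar[OF sim] of_real_hom.char_poly_hom[OF K] ..
    finally show ?thesis using proots_char_poly_one_minus[OF C] by simp
  qed
  have deg: "degree (char_poly ?C) = N" "char_poly ?C \<noteq> 0"
    using degree_monic_char_poly[OF C] by auto
  then have roots: "set_mset (proots (char_poly ?C)) = spectrum ?C"
    using spectrum_root_char_poly[OF C] by simp
  have real: "k \<in> \<real>" if "k \<in> spectrum ?C" for k
  proof (rule eigenvalue_real_if_reversible[OF K, of "\<lambda>i. pair_prod p (e i)"])
    show "eigenvalue ?C k" using that by (simp add: spectrum_def)
    show "0 < pair_prod p (e i)" if "i < N" for i
      using eS[OF that] pos by (intro pair_prod_pos) (auto dest: permutations_of_setD)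
  qed (auto simp: Kij intro!: trans_prob_reversible[OF facts] eS)
  have norm: "cmod k \<le> 1" if "k \<in> spectrum ?C" for k
  proof (rule norm_eigenvalue_le_1_if_stochastic[OF K])
    show "eigenvalue ?C k" using that by (simp add: spectrum_def)
    show "(\<Sum>j<N. ?K $$ (i, j)) = 1" if "i < N" for i
    proof -
      have "(\<Sum>j<N. ?K $$ (i, j)) = (\<Sum>j<N. trans_prob n p (e i) (e j))"
        using that by (simp add: Kij)
      also have "\<dots> = (\<Sum>y\<in>?S. trans_prob n p (e i) y)"
        by (rule sum.reindex_bij_betw[OF e])
      also have "\<dots> = 1"
        using eS[OF that] by (subst sum.remove) (auto simp: trans_prob_diag[of n p "e i"])
      finally show ?thesis .
    qed
  qed (auto simp: Kij intro!: trans_prob_nonneg[OF facts] eS)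
  have "spectrum ?C \<subseteq> complex_of_real ` {0..1}"
  proof
    fix k assume k: "k \<in> spectrum ?C"
    then obtain r where r: "k = of_real r" using real by (auto elim: Reals_cases)
    \<comment> \<open>The reflected eigenvalue also lies in the unit disc, and for real
      \<open>r\<close> the bounds on \<open>r\<close> and \<open>1 - r\<close> together leave only
      \<open>[0, 1]\<close>.\<close>
    have "1 - k \<in> set_mset (image_mset (\<lambda>a. 1 - a) (proots (char_poly ?C)))"
      using k unfolding set_image_mset roots by blast
    then have "1 - k \<in> spectrum ?C" unfolding refl roots .
    then have "cmod (of_real (1 - r)) \<le> 1" using norm r by fastforce
    moreover have "cmod (of_real r) \<le> 1" using norm k r by blast
    ultimately have "r \<in> {0..1}" unfolding norm_of_real by auto
    then show "k \<in> complex_of_real ` {0..1}" using r by blast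
  qed
  moreover have "even N" using \<open>n \<ge> 2\<close> by (simp add: N_def dvd_fact)
  then have "\<exists>P. proots (char_poly ?C) = image_mset fst P + image_mset snd P
      \<and> (\<forall>(a, b) \<in># P. a + b = 1)"
    using real by (intro pair_up_reflected_multiset refl) (auto simp: roots size_proots_complex deg)
  moreover have "similar_mat ?K (1\<^sub>m (fact n) - ?K)"
    using similar_mat_sym[OF sim] by (simp add: N_def)
  ultimately show ?thesis by blast
qed

end
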